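(* Consider the scalar-state setting $n_x=1$. Assume that the prior mean function $m$ is constant; that the covariance function $\kappa$ is stationary and strictly decreasing, i.e. $\kappa(t_1,t_2)<\kappa(t_3,t_4)$ whenever $|t_2-t_1|>|t_4-t_3|$; and that there is a function $\zeta:\mathbb{R}^{n_\theta}\to\mathbb{R}$ of the hyperparameters such that the time derivative $\dot\kappa:=\partial\kappa(\cdot,t')/\partial t$ satisfies $|\dot\kappa(t_1,t_2)|<|\dot\kappa(t_3,t_4)|$ whenever $|t_2-t_1|>|t_4-t_3|>\zeta(\theta)$. Suppose the GP learning algorithm for asymptotically constant references described in the context terminates, that the optimization problem it solves is feasible, and let $(\bar k,\hat\theta)$ be its output. Then the reference $x_r(k):=m^+(T_s k\,|\,D_\theta,\hat\theta)$, $k\in\mathbb{N}_0$, given by the posterior mean of the trained Gaussian process, is trackable for the system $x(k+1)=f(x(k),u(k))$, i.e. for all $k\in\mathbb{N}_0$ one has $x_r(k)\in\mathcal{X}$ and there exists $u_r(k)\in\mathcal{U}$ such that $x_r(k+1)=f(x_r(k),u_r(k))$.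
   Context: System: $x(k+1)=f(x(k),u(k))$, $k\in\mathbb{N}_0$, with state $x\in\mathbb{R}$, input $u\in\mathbb{R}^{n_u}$, state constraint set $\mathcal{X}\subseteq\mathbb{R}$ and input constraint set $\mathcal{U}\subseteq\mathbb{R}^{n_u}$. $T_s>0$ is the sampling time. The one-step reachable set is $\mathcal{R}_1(\{x\})=\{f(x,u):u\in\mathcal{U}\}$. Along a reference $x_r$ the one-step-ahead reachable tube is $\mathcal{T}_{k+1}:=\mathcal{R}_1(\{x_r(k)\})$, $k\in\mathbb{N}_0$, with $\mathcal{T}_0:=\mathbb{R}$ (no reachability constraint at $k=0$). Gaussian process: $m:\mathbb{R}\to\mathbb{R}$ is the prior mean function and $\kappa:\mathbb{R}\times\mathbb{R}\to\mathbb{R}_0^+$ the symmetric positive semidefinite covariance function (with the derivative $\dot\kappa$ existing), both depending on hyperparameters $\theta\in\mathbb{R}^{n_\theta}$. The data set is $D_\theta=\{(t_i,y_i): i=1,\dots,n\}\subset\mathbb{R}_0^+\times\mathbb{R}$; $\boldsymbol{t}=(t_1,\dots,t_n)$, $\boldsymbol{y}=(y_1,\dots,y_n)^\top$, $\boldsymbol{m}(\boldsymbol{t})=(m(t_1),\dots,m(t_n))^\top$; $K(\boldsymbol{t},\boldsymbol{t})=(\kappa(t_i,t_j))_{i,j}$, $K(t_*,\boldsymbol{t})=(\kappa(t_*,t_1),\dots,\kappa(t_*,t_n))$; $\sigma_n^2$ is the noise variance. The posterior mean is $$m^+(t_*|D_\theta,\theta)=m(t_* )+K(t_*,\boldsymbol{t})\big(K(\boldsymbol{t},\boldsymbol{t})+\sigma_n^2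 I\big)^{-1}(\boldsymbol{y}-\boldsymbol{m}(\boldsymbol{t}))=m(t_* )+\sum_{i=1}^{n}c_i\,\kappa(t_i,t_* ),$$ where $c_i$ are the entries of $(K(\boldsymbol{t},\boldsymbol{t})+\sigma_n^2 I)^{-1}(\boldsymbol{y}-\boldsymbol{m}(\boldsymbol{t}))$. Define the bounds $$\bar m(t_* ):=\sum_{i=1}^{n}|c_i|\,\kappa(t_i,t_* ),\qquad \bar{\dot m}(t_* ):=\sum_{i=1}^{n}|c_i|\,|\dot\kappa(t_i,t_* )|.$$ Cost: $l(\theta)=\ln(|K(\boldsymbol{t},\boldsymbol{t})|)+\boldsymbol{y}^\top K(\boldsymbol{t},\boldsymbol{t})^{-1}\boldsymbol{y}+n\ln(2\pi)$. Optimization problem for given $\bar k$: $\hat\theta:=\operatorname{arg\,min}_\theta l(\theta)$ subject to $m^+(T_s k\,|\,D_\theta,\theta)\in\mathcal{T}_k\cap\mathcal{X}$ for all $k\in\{0,\dots,\bar k\}$, the tube being taken along the candidate reference $x_r(k)=m^+(T_sk\,|\,D_\theta,\theta)$. Algorithm (GP learning for asymptotically constant references). Initialize $\bar k$ such that the data times satisfy $t_i\le T_s\bar k$. Repeat: compute $\hat\theta$ by solving the optimization problem with the current $\bar k$; put $\bar t:=T_s\bar k$ and evaluate $\bar m(\bar t)$, $\bar{\dot m}(\bar t)$ for $\hat\theta$; check the following conditions: (i) $|t_i-\bar t|>\zeta(\hat\theta)$ for all $i$; (ii) $\tilde{\mathcal{X}}:=[m(\bar t)-\bar m(\bar t),\,m(\bar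 t)+\bar m(\bar t)]\subseteq\mathcal{X}$; (iii) with constants $\underline\tau,\overline\tau$ chosen such that they give an inner approximation of the one-step reachable tube on $\tilde{\mathcal{X}}$, i.e. $[x+\underline\tau T_s,\;x+\overline\tau T_s]\subseteq\mathcal{R}_1(\{x\})$ for all $x\in\tilde{\mathcal{X}}$, it holds that $\underline\tau\le-\bar{\dot m}(\bar t)$ and $\bar{\dot m}(\bar t)\le\overline\tau$. If all of (i)–(iii) hold, stop and return $(\bar k,\hat\theta)$; otherwise replace $\bar k$ by $\bar k+1$ and repeat. It is assumed that the algorithm terminates in finite time. *)

theory Defs
  imports "HOL-Analysis.Analysis"
begin

definition reach1 :: "(real \<Rightarrow> 'u \<Rightarrow> real) \<Rightarrow> 'u set \<Rightarrow> real set \<Rightarrow> real set" where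
  "reach1 f U S = {f x u | x u. x \<in> S \<and> u \<in> U}"

text \<open>One-step-ahead reachable tube along \<open>xr\<close>; there is no constraint at time 0.\<close>

fun tube :: "(real \<Rightarrow> 'u \<Rightarrow> real) \<Rightarrow> 'u set \<Rightarrow> (nat \<Rightarrow> real) \<Rightarrow> nat \<Rightarrow> real set" where
  "tube f U xr 0 = UNIV"
| "tube f U xr (Suc k) = reach1 f U {xr k}"

definition trackable ::
  "(real \<Rightarrow> 'u \<Rightarrow> real) \<Rightarrow> 'u set \<Rightarrow> real set \<Rightarrow> (nat \<Rightarrow> real) \<Rightarrow> bool" where
  "trackable f U X xr \<longleftrightarrow> (\<forall>k. xr k \<in> X \<and> (\<exists>u\<in>U. xr (Suc k) = f (xr k) u))"

definition inner_approx ::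
  "(real \<Rightarrow> 'u \<Rightarrow> real) \<Rightarrow> 'u set \<Rightarrow> real \<Rightarrow> real set \<Rightarrow> real \<Rightarrow> real \<Rightarrow> bool" where
  "inner_approx f U Ts S \<tau>l \<tau>u \<longleftrightarrow>
     (\<forall>x\<in>S. {x + \<tau>l * Ts .. x + \<tau>u * Ts} \<subseteq> reach1 f U {x})"

definition covariance_function :: "(real \<Rightarrow> real \<Rightarrow> real) \<Rightarrow> bool" where
  "covariance_function \<kappa> \<longleftrightarrow>
     (\<forall>s s'. 0 \<le> \<kappa> s s') \<and> (\<forall>s s'. \<kappa> s s' = \<kappa> s' s) \<and>
     (\<forall>(N::nat) (s::nat \<Rightarrow> real) (a::nat \<Rightarrow> real).
        0 \<le> (\<Sum>i<N. \<Sum>j<N. a i * a j * \<kappa> (s i) (s j)))"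

definition stationary :: "(real \<Rightarrow> real \<Rightarrow> real) \<Rightarrow> bool" where
  "stationary \<kappa> \<longleftrightarrow> (\<exists>g. \<forall>s s'. \<kappa> s s' = g (s - s'))"

definition strictly_decreasing_cov :: "(real \<Rightarrow> real \<Rightarrow> real) \<Rightarrow> bool" where
  "strictly_decreasing_cov \<kappa> \<longleftrightarrow>
     (\<forall>t1 t2 t3 t4. \<bar>t2 - t1\<bar> > \<bar>t4 - t3\<bar> \<longrightarrow> \<kappa> t1 t2 < \<kappa> t3 t4)"

text \<open>The dot always denotes the partial derivative in the first argument.\<close>

definition cov_differentiable :: "(real \<Rightarrow> real \<Rightarrow> real) \<Rightarrow> bool" where
  "cov_differentiable \<kappa> \<longleftrightarrow> (\<forall>s s'. (\<lambda>r. \<kappa> r s') field_differentiable at s)"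

definition cov_dot :: "(real \<Rightarrow> real \<Rightarrow> real) \<Rightarrow> real \<Rightarrow> real \<Rightarrow> real" where
  "cov_dot \<kappa> s s' = deriv (\<lambda>r. \<kappa> r s') s"

text \<open>
  The \<open>n\<close> data points are the pairs \<open>(t $ i, y $ i)\<close>; \<open>m\<close> and \<open>\<kappa>\<close> are the mean and
  covariance for one fixed value of the hyperparameters, and \<open>\<sigma>\<close> is the standard
  deviation of the noise, i.e. the noise variance is \<open>\<sigma>\<^sup>2\<close>.
\<close>

definition gram :: "(real \<Rightarrow> real \<Rightarrow> real) \<Rightarrow> real ^ 'n \<Rightarrow> real ^ 'n ^ 'n" where
  "gram \<kappa> t = (\<chi> i j. \<kappa> (t $ i) (t $ j))"

definition weights ::
  "real \<Rightarrow> real ^ 'n \<Rightarrow> real ^ 'n \<Rightarrow> (real \<Rightarrow> real) \<Rightarrow> (real \<Rightarrow> real \<Rightarrow> real) \<Rightarrow> real ^ 'n" where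
  "weights \<sigma> t y m \<kappa> = matrix_inv (gram \<kappa> t + mat (\<sigma>\<^sup>2)) *v (y - (\<chi> i. m (t $ i)))"

definition post_mean ::
  "real \<Rightarrow> real ^ 'n \<Rightarrow> real ^ 'n \<Rightarrow> (real \<Rightarrow> real) \<Rightarrow> (real \<Rightarrow> real \<Rightarrow> real) \<Rightarrow> real \<Rightarrow> real" where
  "post_mean \<sigma> t y m \<kappa> s = m s + (\<chi> i. \<kappa> s (t $ i)) \<bullet> weights \<sigma> t y m \<kappa>"

definition mean_bound ::
  "real \<Rightarrow> real ^ 'n \<Rightarrow> real ^ 'n \<Rightarrow> (real \<Rightarrow> real) \<Rightarrow> (real \<Rightarrow> real \<Rightarrow> real) \<Rightarrow> real \<Rightarrow> real" where
  "mean_bound \<sigma> t y m \<kappa> s = (\<Sum>i\<in>UNIV. \<bar>weights \<sigma> t y m \<kappa> $ i\<bar> * \<kappa> (t $ i) s)"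

definition mean_dot_bound ::
  "real \<Rightarrow> real ^ 'n \<Rightarrow> real ^ 'n \<Rightarrow> (real \<Rightarrow> real) \<Rightarrow> (real \<Rightarrow> real \<Rightarrow> real) \<Rightarrow> real \<Rightarrow> real" where
  "mean_dot_bound \<sigma> t y m \<kappa> s =
     (\<Sum>i\<in>UNIV. \<bar>weights \<sigma> t y m \<kappa> $ i\<bar> * \<bar>cov_dot \<kappa> (t $ i) s\<bar>)"

definition gp_cost :: "real ^ 'n \<Rightarrow> real ^ 'n \<Rightarrow> (real \<Rightarrow> real \<Rightarrow> real) \<Rightarrow> real" where
  "gp_cost t y \<kappa> =
     ln (det (gram \<kappa> t)) + y \<bullet> (matrix_inv (gram \<kappa> t) *v y) + real CARD('n) * ln (2 * pi)"

text \<open>From here on \<open>m\<close> and \<open>\<kappa>\<close> are families indexed by the hyperparameters \<open>\<theta>\<close>.\<close>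

definition gp_reference ::
  "real \<Rightarrow> real \<Rightarrow> real ^ 'n \<Rightarrow> real ^ 'n \<Rightarrow> ('h \<Rightarrow> real \<Rightarrow> real) \<Rightarrow>
   ('h \<Rightarrow> real \<Rightarrow> real \<Rightarrow> real) \<Rightarrow> 'h \<Rightarrow> nat \<Rightarrow> real" where
  "gp_reference Ts \<sigma> t y m \<kappa> \<theta> k = post_mean \<sigma> t y (m \<theta>) (\<kappa> \<theta>) (Ts * real k)"

definition gp_feasible ::
  "(real \<Rightarrow> 'u \<Rightarrow> real) \<Rightarrow> 'u set \<Rightarrow> real set \<Rightarrow> real \<Rightarrow> real \<Rightarrow> real ^ 'n \<Rightarrow> real ^ 'n \<Rightarrow>
   ('h \<Rightarrow> real \<Rightarrow> real) \<Rightarrow> ('h \<Rightarrow> real \<Rightarrow> real \<Rightarrow> real) \<Rightarrow> nat \<Rightarrow> 'h \<Rightarrow> bool" where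
  "gp_feasible f U X Ts \<sigma> t y m \<kappa> kb \<theta> \<longleftrightarrow>
     (\<forall>k\<in>{0..kb}. gp_reference Ts \<sigma> t y m \<kappa> \<theta> k
                     \<in> tube f U (gp_reference Ts \<sigma> t y m \<kappa> \<theta>) k \<inter> X)"

definition gp_optimal ::
  "(real \<Rightarrow> 'u \<Rightarrow> real) \<Rightarrow> 'u set \<Rightarrow> real set \<Rightarrow> real \<Rightarrow> real \<Rightarrow> real ^ 'n \<Rightarrow> real ^ 'n \<Rightarrow>
   ('h \<Rightarrow> real \<Rightarrow> real) \<Rightarrow> ('h \<Rightarrow> real \<Rightarrow> real \<Rightarrow> real) \<Rightarrow> nat \<Rightarrow> 'h \<Rightarrow> bool" where
  "gp_optimal f U X Ts \<sigma> t y m \<kappa> kb \<theta> \<longleftrightarrow>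
     is_arg_min (\<lambda>\<theta>. gp_cost t y (\<kappa> \<theta>)) (gp_feasible f U X Ts \<sigma> t y m \<kappa> kb) \<theta>"

definition state_bound ::
  "real \<Rightarrow> real \<Rightarrow> real ^ 'n \<Rightarrow> real ^ 'n \<Rightarrow> ('h \<Rightarrow> real \<Rightarrow> real) \<Rightarrow>
   ('h \<Rightarrow> real \<Rightarrow> real \<Rightarrow> real) \<Rightarrow> nat \<Rightarrow> 'h \<Rightarrow> real set" where
  "state_bound Ts \<sigma> t y m \<kappa> kb \<theta> =
     (let tb = Ts * real kb; mb = mean_bound \<sigma> t y (m \<theta>) (\<kappa> \<theta>) tb
      in {m \<theta> tb - mb .. m \<theta> tb + mb})"

definition gp_stop ::
  "real set \<Rightarrow> real \<Rightarrow> real \<Rightarrow> real ^ 'n \<Rightarrow> real ^ 'n \<Rightarrow> ('h \<Rightarrow> real \<Rightarrow> real) \<Rightarrow>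
   ('h \<Rightarrow> real \<Rightarrow> real \<Rightarrow> real) \<Rightarrow> ('h \<Rightarrow> real) \<Rightarrow> real \<Rightarrow> real \<Rightarrow> nat \<Rightarrow> 'h \<Rightarrow> bool" where
  "gp_stop X Ts \<sigma> t y m \<kappa> \<zeta> \<tau>l \<tau>u kb \<theta> \<longleftrightarrow>
     (let tb = Ts * real kb; mdb = mean_dot_bound \<sigma> t y (m \<theta>) (\<kappa> \<theta>) tb
      in (\<forall>i. \<bar>t $ i - tb\<bar> > \<zeta> \<theta>) \<and>
         state_bound Ts \<sigma> t y m \<kappa> kb \<theta> \<subseteq> X \<and>
         \<tau>l \<le> - mdb \<and> mdb \<le> \<tau>u)"

text \<open>
  \<open>gp_loop \<dots> kb r\<close>: the loop, entered with horizon \<open>kb\<close>, terminates after finitely many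
  passes and returns \<open>r\<close>.  In each pass the minimiser \<open>\<theta>\<close> and the constants \<open>\<tau>l\<close>, \<open>\<tau>u\<close>
  of the inner approximation are arbitrary admissible choices, so that every way of
  solving the optimisation problem and of choosing these constants is covered.
\<close>

inductive gp_loop ::
  "(real \<Rightarrow> 'u \<Rightarrow> real) \<Rightarrow> 'u set \<Rightarrow> real set \<Rightarrow> real \<Rightarrow> real \<Rightarrow> real ^ 'n \<Rightarrow> real ^ 'n \<Rightarrow>
   ('h \<Rightarrow> real \<Rightarrow> real) \<Rightarrow> ('h \<Rightarrow> real \<Rightarrow> real \<Rightarrow> real) \<Rightarrow> ('h \<Rightarrow> real) \<Rightarrow>
   nat \<Rightarrow> nat \<times> 'h \<Rightarrow> bool"
  for f U X Ts \<sigma> t y m \<kappa> \<zeta> where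
  stop: "\<lbrakk> gp_optimal f U X Ts \<sigma> t y m \<kappa> kb \<theta>;
           inner_approx f U Ts (state_bound Ts \<sigma> t y m \<kappa> kb \<theta>) \<tau>l \<tau>u;
           gp_stop X Ts \<sigma> t y m \<kappa> \<zeta> \<tau>l \<tau>u kb \<theta> \<rbrakk>
         \<Longrightarrow> gp_loop f U X Ts \<sigma> t y m \<kappa> \<zeta> kb (kb, \<theta>)"
| step: "\<lbrakk> gp_optimal f U X Ts \<sigma> t y m \<kappa> kb \<theta>;
           inner_approx f U Ts (state_bound Ts \<sigma> t y m \<kappa> kb \<theta>) \<tau>l \<tau>u;
           \<not> gp_stop X Ts \<sigma> t y m \<kappa> \<zeta> \<tau>l \<tau>u kb \<theta>;
           gp_loop f U X Ts \<sigma> t y m \<kappa> \<zeta> (kb + 1) r \<rbrakk>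
         \<Longrightarrow> gp_loop f U X Ts \<sigma> t y m \<kappa> \<zeta> kb r"

end

theory Submission
  imports Defs
begin

text \<open>
  On \<open>{0..kb}\<close> the reference satisfies both constraints because the returned hyperparameters
  are feasible for the last optimization problem.  Beyond \<open>Ts * kb\<close> every data time lies in
  the past, so the covariances and their derivatives are dominated by their values at
  \<open>Ts * kb\<close>: the posterior mean stays within \<open>mean_bound\<close> of the constant prior mean, and by the
  mean value theorem one step changes it by at most \<open>Ts\<close> times \<open>mean_dot_bound\<close>, which the
  inner approximation of the reachable tube permits.
\<close>

text \<open>A result can only be produced by the rule \<open>stop\<close>, and \<open>step\<close>
  passes it through unchanged, so the facts checked in the last pass survive; a minimiser is in
  particular feasible. Since \<open>step\<close> only raises the horizon,
  \<open>k0 \<le> kb\<close>, which later keeps all data times at or before the final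
  horizon.\<close>

lemma gp_loop_returns:
  assumes "gp_loop f U X Ts \<sigma> t y m \<kappa> \<zeta> k0 (kb, \<theta>)"
  obtains \<tau>l \<tau>u where "k0 \<le> kb" "gp_feasible f U X Ts \<sigma> t y m \<kappa> kb \<theta>"
    "inner_approx f U Ts (state_bound Ts \<sigma> t y m \<kappa> kb \<theta>) \<tau>l \<tau>u"
    "gp_stop X Ts \<sigma> t y m \<kappa> \<zeta> \<tau>l \<tau>u kb \<theta>"
proof -
  have "k0 \<le> kb \<and> gp_feasible f U X Ts \<sigma> t y m \<kappa> kb \<theta> \<and>
    (\<exists>\<tau>l \<tau>u. inner_approx f U Ts (state_bound Ts \<sigma> t y m \<kappa> kb \<theta>) \<tau>l \<tau>u \<and>
            gp_stop X Ts \<sigma> t y m \<kappa> \<zeta> \<tau>l \<tau>u kb \<theta>)"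
    using assms
  proof (induction k0 "(kb, \<theta>)" rule: gp_loop.induct)
    case (stop \<tau>l \<tau>u)
    then show ?case by (auto simp: gp_optimal_def is_arg_min_def)
  next
    case step
    then show ?case by simp
  qed
  then show thesis using that by blast
qed

lemma post_mean_sum:
  "post_mean \<sigma> t y m \<kappa> s = m s + (\<Sum>i\<in>UNIV. weights \<sigma> t y m \<kappa> $ i * \<kappa> s (t $ i))"
  by (simp add: post_mean_def inner_vec_def mult.commute)

lemma post_mean_deviation_le:
  assumes "covariance_function \<kappa>" "strictly_decreasing_cov \<kappa>"
    and "\<And>i. t $ i \<le> tb" "tb \<le> s"
  shows "\<bar>post_mean \<sigma> t y m \<kappa> s - m s\<bar> \<le> mean_bound \<sigma> t y m \<kappa> tb"
proof -
  have nonneg: "0 \<le> \<kappa> a b" and sym: "\<kappa> a b = \<kappa> b a" for a b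
    using assms(1) by (auto simp: covariance_function_def)
  \<comment> \<open>The decrease hypothesis demands a strictly larger lag. At \<open>s = tb\<close>
    the two lags agree, and symmetry gives equality instead.\<close>
  have "\<kappa> s (t $ i) \<le> \<kappa> (t $ i) tb" for i
  proof (cases "s = tb")
    case True
    then show ?thesis by (simp add: sym)
  next
    case False
    then have "\<bar>t $ i - s\<bar> > \<bar>tb - t $ i\<bar>"
      using assms(3)[of i] assms(4) by linarith
    then show ?thesis
      using assms(2) unfolding strictly_decreasing_cov_def by (meson less_imp_le)
  qed
  then have "\<bar>weights \<sigma> t y m \<kappa> $ i * \<kappa> s (t $ i)\<bar>
      \<le> \<bar>weights \<sigma> t y m \<kappa> $ i\<bar> * \<kappa> (t $ i) tb" for i
    by (simp add: abs_mult nonneg mult_left_mono)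
  then show ?thesis
    unfolding post_mean_sum mean_bound_def
    by (simp add: order_trans[OF sum_abs] sum_mono)
qed

text \<open>The dot of \<open>cov_dot\<close> acts on the first argument, which is where
  \<open>post_mean\<close> puts the query time; the constant prior mean contributes nothing.\<close>

lemma post_mean_has_derivative:
  assumes "cov_differentiable \<kappa>"
  shows "(post_mean \<sigma> t y (\<lambda>_. c) \<kappa> has_real_derivative
    (\<Sum>i\<in>UNIV. weights \<sigma> t y (\<lambda>_. c) \<kappa> $ i * cov_dot \<kappa> s (t $ i))) (at s)"
proof -
  have "((\<lambda>r. \<kappa> r b) has_real_derivative cov_dot \<kappa> s b) (at s)" for b
    using assms unfolding cov_differentiable_def cov_dot_def
    by (simp add: DERIV_deriv_iff_field_differentiable)
  then show ?thesis
    unfolding post_mean_sum[abs_def]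
    by (auto intro!: derivative_eq_intros simp: mult.commute)
qed

lemma post_mean_step_le:
  assumes "cov_differentiable \<kappa>"
    and "\<And>t1 t2 t3 t4. \<bar>t2 - t1\<bar> > \<bar>t4 - t3\<bar> \<Longrightarrow> \<bar>t4 - t3\<bar> > z \<Longrightarrow>
           \<bar>cov_dot \<kappa> t1 t2\<bar> < \<bar>cov_dot \<kappa> t3 t4\<bar>"
    and "\<And>i. t $ i \<le> tb" "\<And>i. \<bar>t $ i - tb\<bar> > z"
    and "tb \<le> s" "s < s'"
  shows "\<bar>post_mean \<sigma> t y (\<lambda>_. c) \<kappa> s' - post_mean \<sigma> t y (\<lambda>_. c) \<kappa> s\<bar>
    \<le> (s' - s) * mean_dot_bound \<sigma> t y (\<lambda>_. c) \<kappa> tb"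
proof -
  define w where "w = weights \<sigma> t y (\<lambda>_. c) \<kappa>"
  \<comment> \<open>The intermediate point lies strictly beyond \<open>s\<close>, hence strictly
    beyond \<open>tb\<close> even when \<open>s = tb\<close>, so the strict lag comparison below
    applies without a boundary case.\<close>
  obtain r where r: "s < r" and mvt: "post_mean \<sigma> t y (\<lambda>_. c) \<kappa> s' - post_mean \<sigma> t y (\<lambda>_. c) \<kappa> s
      = (s' - s) * (\<Sum>i\<in>UNIV. w $ i * cov_dot \<kappa> r (t $ i))"
    using MVT2[OF \<open>s < s'\<close> post_mean_has_derivative[OF assms(1)]] unfolding w_def by metis
  \<comment> \<open>The comparison of derivatives sees only lags and absolute values, so it also
    absorbs the exchanged order of arguments on the right. The threshold \<open>z\<close> has to be
    exceeded by the smaller lag, the one to \<open>tb\<close>.\<close>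
  have "\<bar>w $ i * cov_dot \<kappa> r (t $ i)\<bar> \<le> \<bar>w $ i\<bar> * \<bar>cov_dot \<kappa> (t $ i) tb\<bar>" for i
  proof -
    have "\<bar>t $ i - r\<bar> > \<bar>tb - t $ i\<bar>" "\<bar>tb - t $ i\<bar> > z"
      using assms(3,4)[of i] assms(5) r by linarith+
    then have "\<bar>cov_dot \<kappa> r (t $ i)\<bar> < \<bar>cov_dot \<kappa> (t $ i) tb\<bar>"
      by (rule assms(2))
    then show ?thesis by (simp add: abs_mult mult_left_mono)
  qed
  then have "\<bar>\<Sum>i\<in>UNIV. w $ i * cov_dot \<kappa> r (t $ i)\<bar>
      \<le> mean_dot_bound \<sigma> t y (\<lambda>_. c) \<kappa> tb"
    unfolding mean_dot_bound_def w_def[symmetric]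
    by (simp add: order_trans[OF sum_abs] sum_mono)
  then show ?thesis
    using \<open>s < s'\<close> unfolding mvt by (simp add: abs_mult mult_left_mono)
qed

theorem lemma1:
  fixes f :: "real \<Rightarrow> real ^ 'u \<Rightarrow> real"
    and U :: "(real ^ 'u) set" and X :: "real set"
    and Ts \<sigma> :: real
    and t y :: "real ^ 'n"
    and m :: "real ^ 'h \<Rightarrow> real \<Rightarrow> real"
    and \<kappa> :: "real ^ 'h \<Rightarrow> real \<Rightarrow> real \<Rightarrow> real"
    and \<zeta> :: "real ^ 'h \<Rightarrow> real"
    and k0 kb :: nat
    and \<theta>hat :: "real ^ 'h"
  assumes Ts_pos: "Ts > 0"
    and data_times: "\<forall>i. 0 \<le> t $ i"
    and cov: "\<forall>\<theta>. covariance_function (\<kappa> \<theta>)"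
    and diff: "\<forall>\<theta>. cov_differentiable (\<kappa> \<theta>)"
    and mean_const: "\<forall>\<theta>. \<exists>c. \<forall>s. m \<theta> s = c"
    and stat: "\<forall>\<theta>. stationary (\<kappa> \<theta>)"
    and decr: "\<forall>\<theta>. strictly_decreasing_cov (\<kappa> \<theta>)"
    and dot_decr: "\<forall>\<theta> t1 t2 t3 t4. \<bar>t2 - t1\<bar> > \<bar>t4 - t3\<bar> \<and> \<bar>t4 - t3\<bar> > \<zeta> \<theta> \<longrightarrow>
                     \<bar>cov_dot (\<kappa> \<theta>) t1 t2\<bar> < \<bar>cov_dot (\<kappa> \<theta>) t3 t4\<bar>"
    and init: "\<forall>i. t $ i \<le> Ts * real k0"
    and feasible: "\<forall>k\<in>{k0..kb}. \<exists>\<theta>. gp_feasible f U X Ts \<sigma> t y m \<kappa> k \<theta>"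
    and returns: "gp_loop f U X Ts \<sigma> t y m \<kappa> \<zeta> k0 (kb, \<theta>hat)"
  shows "trackable f U X (gp_reference Ts \<sigma> t y m \<kappa> \<theta>hat)"
proof -
  define xr where "xr = gp_reference Ts \<sigma> t y m \<kappa> \<theta>hat"
  define tb where "tb = Ts * real kb"
  obtain \<tau>l \<tau>u where "k0 \<le> kb"
    and feas: "gp_feasible f U X Ts \<sigma> t y m \<kappa> kb \<theta>hat"
    and inner: "inner_approx f U Ts (state_bound Ts \<sigma> t y m \<kappa> kb \<theta>hat) \<tau>l \<tau>u"
    and stop: "gp_stop X Ts \<sigma> t y m \<kappa> \<zeta> \<tau>l \<tau>u kb \<theta>hat"
    using returns by (rule gp_loop_returns)
  obtain c where m: "m \<theta>hat = (\<lambda>_. c)"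
    using mean_const by blast
  define mb where "mb = mean_bound \<sigma> t y (\<lambda>_. c) (\<kappa> \<theta>hat) tb"
  define mdb where "mdb = mean_dot_bound \<sigma> t y (\<lambda>_. c) (\<kappa> \<theta>hat) tb"
  have far: "\<forall>i. \<bar>t $ i - tb\<bar> > \<zeta> \<theta>hat"
    and in_X: "{c - mb .. c + mb} \<subseteq> X" and rates: "\<tau>l \<le> - mdb" "mdb \<le> \<tau>u"
    using stop unfolding gp_stop_def Let_def state_bound_def tb_def mb_def mdb_def m by auto
  have reach: "{x + \<tau>l * Ts .. x + \<tau>u * Ts} \<subseteq> reach1 f U {x}" if "x \<in> {c - mb .. c + mb}" for x
    using inner that
    unfolding inner_approx_def state_bound_def Let_def tb_def mb_def m by blast
  have past: "t $ i \<le> tb" for i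
  proof -
    have "Ts * real k0 \<le> tb"
      using \<open>k0 \<le> kb\<close> Ts_pos by (simp add: tb_def)
    then show ?thesis using init order_trans by blast
  qed
  have late: "xr k \<in> {c - mb .. c + mb}" "xr (Suc k) \<in> reach1 f U {xr k}" if "kb \<le> k" for k
  proof -
    have s: "tb \<le> Ts * real k" and s': "Ts * real k < Ts * real (Suc k)"
      using that Ts_pos by (simp_all add: tb_def)
    have "\<bar>xr k - c\<bar> \<le> mb"
      using post_mean_deviation_le[OF cov[rule_format] decr[rule_format] past s, of \<sigma> y "\<lambda>_. c"]
      by (simp add: xr_def gp_reference_def m mb_def)
    then show bounds: "xr k \<in> {c - mb .. c + mb}"
      by auto
    have "\<bar>xr (Suc k) - xr k\<bar> \<le> (Ts * real (Suc k) - Ts * real k) * mdb"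
      unfolding xr_def gp_reference_def m mdb_def
      using diff dot_decr past far s s' by (intro post_mean_step_le) blast+
    then have "\<bar>xr (Suc k) - xr k\<bar> \<le> mdb * Ts"
      by (simp add: algebra_simps)
    \<comment> \<open>The stopping test bounds rates; scaling by \<open>Ts\<close> turns it into a
      bound on the increment over one sampling period.\<close>
    moreover have "\<tau>l * Ts \<le> - mdb * Ts" "mdb * Ts \<le> \<tau>u * Ts"
      using rates Ts_pos by (intro mult_right_mono; simp)+
    ultimately have "xr (Suc k) \<in> {xr k + \<tau>l * Ts .. xr k + \<tau>u * Ts}"
      by auto
    then show "xr (Suc k) \<in> reach1 f U {xr k}"
      using reach[OF bounds] by blast
  qed
  have early: "xr k \<in> tube f U xr k \<inter> X" if "k \<le> kb" for k
    using feas that unfolding gp_feasible_def xr_def[symmetric] by simp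
  have "xr k \<in> X \<and> xr (Suc k) \<in> reach1 f U {xr k}" for k
  \<comment> \<open>Feasibility covers the tube only up to index \<open>kb\<close>, that is, steps
    starting before \<open>kb\<close>. The step from \<open>kb\<close> to \<open>Suc kb\<close>
    already belongs to the late regime.\<close>
  proof (cases "k < kb")
    case True
    \<comment> \<open>Membership in \<open>X\<close> comes from index \<open>k\<close>, reachability
      from index \<open>Suc k\<close>, where the tube is never the trivial
      \<open>UNIV\<close>.\<close>
    then show ?thesis using early[of k] early[of "Suc k"] by simp
  next
    case False
    then show ?thesis using late[of k] in_X by auto
  qed
  then show ?thesis
    unfolding trackable_def xr_def[symmetric] reach1_def by blast
qed

end
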